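(* Let $\Sigma=(X,U_c,\phi)$ be a time-invariant control system (satisfying the BIC property), and let $x\equiv 0$ be its equilibrium point. Assume that for all $u\in U_c$ and all $s\ge 0$ the function $\tilde u$ defined by $\tilde u(\tau)=u(\tau+s)$ for all $\tau\ge 0$ belongs to $U_c$ and satisfies $\|\tilde u\|_{U_c}\le\|u\|_{U_c}$. If $\Sigma$ possesses a local ISS-Lyapunov function, then $\Sigma$ is locally input-to-state stable (LISS). If $\Sigma$ possesses an ISS-Lyapunov function, then $\Sigma$ is input-to-state stable (ISS).
   Context: Notation: $\mathbb{R}_+=[0,\infty)$. $\mathcal K$ is the set of continuous strictly increasing $\gamma:\mathbb{R}_+\to\mathbb{R}_+$ with $\gamma(0)=0$; $\mathcal K_\infty$ is the set of unbounded $\gamma\in\mathcal K$; $\mathcal L$ is the set of continuous decreasing $\gamma:\mathbb{R}_+\to\mathbb{R}_+$ with $\lim_{t\to\infty}\gamma(t)=0$; $\mathcal{KL}$ is the set of $\beta:\mathbb{R}_+^2\to\mathbb{R}_+$ with $\beta(\cdot,t)\in\mathcal K$ for all $t\ge0$ and $\beta(r,\cdot)\in\mathcal L$ for all $r>0$. A function $\alpha:\mathbb{R}_+\to\mathbb{R}_+$ is positive definite if $\alpha(0)=0$ and $\alpha(r)>0$ for $r>0$. Control system: a triple $\Sigma=(X,U_c,\phi)$ consisting of a state space $X$ and a space of admissible input functions $U_c\subset\{f:\mathbb{R}_+\to U\}$ ($U$ is the normed space of input values), both linear normed spaces with norms $\|\cdot\|_X$ and $\|\cdot\|_{U_c}$,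 and a transition map $\phi:A_\phi\to X$, $A_\phi\subset\mathbb{R}_+\times\mathbb{R}_+\times X\times U_c$, such that: (Existence) for every $(t_0,x_0,u)\in\mathbb{R}_+\times X\times U_c$ there is $t>t_0$ with $[t_0,t]\times\{(t_0,x_0,u)\}\subset A_\phi$; (Identity) $\phi(t_0,t_0,x_0,\cdot)=x_0$ for every $(t_0,x_0)$; (Causality) if $(t,t_0,x_0,u)\in A_\phi$ and $\tilde u\in U_c$ satisfies $u(s)=\tilde u(s)$ for $s\in[t_0,t]$, then $(t,t_0,x_0,\tilde u)\in A_\phi$ and $\phi(t,t_0,x_0,u)=\phi(t,t_0,x_0,\tilde u)$; (Continuity) for each $(t_0,x_0,u)$ the map $t\mapsto\phi(t,t_0,x_0,u)$ is continuous; (Semigroup property) if $t\ge s\ge0$ and $(t,s,x,u)\in A_\phi$, then for all $r\in[s,t]$ one has $(r,s,x,u)\in A_\phi$ and $\phi(t,r,\phi(r,s,x,u),u)=\phi(t,s,x,u)$. Here $\phi(t,s,x,u)$ is the state at time $t$ if the state at time $s$ was $x$ and the input $u$ was applied. BIC (boundedness-implies-continuation) property: for every $(t_0,x_0,u)\in\mathbb{R}_+\times X\times U_c$ there is a maximal existence time $t_m\in(t_0,\infty]$ with $[t_0,t_m)\times\{(t_0,x_0,u)\}\subset A_\phi$ and $(t,t_0,x_0,u)\notin A_\phi$ for all $t\ge t_m$; moreover, if $t_m<\infty$, then for every $M>0$ there is $t\in[t_0,t_m)$ with $\|\phi(t,t_0,x_0,u)\|_X>M$. Time-invariance: the future evolution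 of the system depends only on the initial state and on the applied input, but not on the initial time; hence one takes initial time $0$ and writes $\phi(t,x,u):=\phi(t,0,x,u)$. A point $x_0\in X$ is an equilibrium point of $\Sigma$ if $\phi(t,x_0,0)=x_0$ for all $t\ge0$. LISS: there exist $\rho_x,\rho_u>0$, $\beta\in\mathcal{KL}$ and $\gamma\in\mathcal K$ such that $\|\phi(t,x_0,u)\|_X\le\beta(\|x_0\|_X,t)+\gamma(\|u\|_{U_c})$ holds for all $x_0$ with $\|x_0\|_X\le\rho_x$, all $t\ge0$ and all $u\in U_c$ with $\|u\|_{U_c}\le\rho_u$. ISS: the same with $\rho_x$ and $\rho_u$ equal to $\infty$. Local ISS-Lyapunov function: a continuous function $V:D\to\mathbb{R}_+$, $D\subset X$, $0\in\mathrm{int}(D)=D\setminus\partial D$, for which there exist $\rho_x,\rho_u>0$, $\psi_1,\psi_2\in\mathcal K_\infty$, $\chi\in\mathcal K$ and a positive definite function $\alpha$ such that $\psi_1(\|x\|_X)\le V(x)\le\psi_2(\|x\|_X)$ for all $x\in D$, and for all $x\in X$ with $\|x\|_X\le\rho_x$ and all $u\in U_c$ with $\|u\|_{U_c}\le\rho_u$: $$\|x\|_X\ge\chi(\|u\|_{U_c})\ \Rightarrow\ \dot V_u(x)\le-\alpha(\|x\|_X),$$ where $\dot V_u(x)=\limsup_{t\to+0}\frac1t\big(V(\phi(t,x,u))-V(x)\big)$. ISS-Lyapunov function: the same with $D=X$, $\rho_x=\infty$ and $\rho_u=\infty$.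
   Formalization: The positive definite decay rate α in the (local) ISS-Lyapunov function is required to be continuous; without this the claim is false (x'=-(x-1)² for x>1, x'=-x on [0,1], odd extension, V=|x|: solutions from above 1 tend to 1). *)

theory Defs
  imports "HOL-Analysis.Analysis"
begin

text \<open>Functions on the half line \<open>[0,\<infinity>)\<close> are functions on \<^typ>\<open>real\<close> of which only the restriction
  to \<open>{0..}\<close> matters. In the first two definitions non-negativity of the values is a consequence.\<close>

definition class_K :: "(real \<Rightarrow> real) \<Rightarrow> bool" where
  "class_K \<gamma> \<longleftrightarrow> continuous_on {0..} \<gamma> \<and> strict_mono_on {0..} \<gamma> \<and> \<gamma> 0 = 0"

definition class_L :: "(real \<Rightarrow> real) \<Rightarrow> bool" where
  "class_L \<gamma> \<longleftrightarrow> continuous_on {0..} \<gamma> \<and> monotone_on {0..} (<) (>) \<gamma> \<and> (\<gamma> \<longlongrightarrow> 0) at_top"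

definition class_Kinf :: "(real \<Rightarrow> real) \<Rightarrow> bool" where
  "class_Kinf \<gamma> \<longleftrightarrow> class_K \<gamma> \<and> \<not> bdd_above (\<gamma> ` {0..})"

definition class_KL :: "(real \<Rightarrow> real \<Rightarrow> real) \<Rightarrow> bool" where
  "class_KL \<beta> \<longleftrightarrow> (\<forall>t\<ge>0. class_K (\<lambda>r. \<beta> r t)) \<and> (\<forall>r>0. class_L (\<beta> r))"

text \<open>As usual for comparison functions, positive definite functions are taken to be continuous.
  Continuity of the decay rate cannot be dropped: the flow of \<open>x' = -(x-1)\<^sup>2\<close> for \<open>x > 1\<close> and
  \<open>x' = -x\<close> for \<open>x \<le> 1\<close> has the Lyapunov function \<open>V x = \<bar>x\<bar>\<close>, with the discontinuous rate
  \<open>\<alpha> r = min r ((r-1)\<^sup>2)\<close> for \<open>r > 1\<close> and \<open>\<alpha> r = r\<close> for \<open>r \<le> 1\<close>, but solutions starting above \<open>1\<close>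
  converge to \<open>1\<close>.\<close>

definition pos_def_fun :: "(real \<Rightarrow> real) \<Rightarrow> bool" where
  "pos_def_fun \<alpha> \<longleftrightarrow> continuous_on {0..} \<alpha> \<and> \<alpha> 0 = 0 \<and> (\<forall>r>0. \<alpha> r > 0)"

text \<open>An input on \<open>[0,\<infinity>)\<close> is represented by its extension by \<open>0\<close> to negative times, so that equality
  and the pointwise linear operations are those of functions on \<open>[0,\<infinity>)\<close>.\<close>

locale input_space =
  fixes Uc :: "(real \<Rightarrow> 'u::real_normed_vector) set"
    and normU :: "(real \<Rightarrow> 'u) \<Rightarrow> real"
  assumes vanish_neg: "\<lbrakk>u \<in> Uc; \<tau> < 0\<rbrakk> \<Longrightarrow> u \<tau> = 0"
    and zero_mem: "(\<lambda>_. 0) \<in> Uc"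
    and add_mem: "\<lbrakk>u \<in> Uc; v \<in> Uc\<rbrakk> \<Longrightarrow> (\<lambda>\<tau>. u \<tau> + v \<tau>) \<in> Uc"
    and scaleR_mem: "u \<in> Uc \<Longrightarrow> (\<lambda>\<tau>. c *\<^sub>R u \<tau>) \<in> Uc"
    and normU_nonneg: "u \<in> Uc \<Longrightarrow> normU u \<ge> 0"
    and normU_eq_0_iff: "u \<in> Uc \<Longrightarrow> normU u = 0 \<longleftrightarrow> u = (\<lambda>_. 0)"
    and normU_triangle: "\<lbrakk>u \<in> Uc; v \<in> Uc\<rbrakk> \<Longrightarrow> normU (\<lambda>\<tau>. u \<tau> + v \<tau>) \<le> normU u + normU v"
    and normU_scaleR: "u \<in> Uc \<Longrightarrow> normU (\<lambda>\<tau>. c *\<^sub>R u \<tau>) = \<bar>c\<bar> * normU u"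

text \<open>\<open>A\<close> is the domain of the transition map; \<open>phi t s x u\<close> is meaningful only for
  \<open>(t, s, x, u) \<in> A\<close>.\<close>

locale control_system = input_space Uc normU
  for Uc :: "(real \<Rightarrow> 'u::real_normed_vector) set" and normU +
  fixes A :: "(real \<times> real \<times> 'x::real_normed_vector \<times> (real \<Rightarrow> 'u)) set"
    and phi :: "real \<Rightarrow> real \<Rightarrow> 'x \<Rightarrow> (real \<Rightarrow> 'u) \<Rightarrow> 'x"
  assumes domain: "A \<subseteq> {0..} \<times> {0..} \<times> UNIV \<times> Uc"
    and existence: "\<lbrakk>t0 \<ge> 0; u \<in> Uc\<rbrakk> \<Longrightarrow> \<exists>t>t0. {t0..t} \<times> {(t0, x0, u)} \<subseteq> A"
    and identity: "\<lbrakk>t0 \<ge> 0; u \<in> Uc\<rbrakk> \<Longrightarrow> phi t0 t0 x0 u = x0"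
    and causality: "\<lbrakk>(t, t0, x0, u) \<in> A; v \<in> Uc; \<forall>s\<in>{t0..t}. u s = v s\<rbrakk>
      \<Longrightarrow> (t, t0, x0, v) \<in> A \<and> phi t t0 x0 u = phi t t0 x0 v"
    and continuity: "\<lbrakk>t0 \<ge> 0; u \<in> Uc\<rbrakk>
      \<Longrightarrow> continuous_on {t. (t, t0, x0, u) \<in> A} (\<lambda>t. phi t t0 x0 u)"
    and semigroup: "\<lbrakk>t \<ge> s; s \<ge> 0; (t, s, x, u) \<in> A; r \<in> {s..t}\<rbrakk>
      \<Longrightarrow> (r, s, x, u) \<in> A \<and> (t, r, phi r s x u, u) \<in> A \<and> phi t r (phi r s x u) u = phi t s x u"

definition BIC where
  "BIC Uc A phi \<longleftrightarrow>
    (\<forall>t0\<ge>0. \<forall>x0. \<forall>u\<in>Uc. \<exists>tm::ereal. ereal t0 < tm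
      \<and> (\<forall>t\<ge>t0. ereal t < tm \<longrightarrow> (t, t0, x0, u) \<in> A)
      \<and> (\<forall>t. tm \<le> ereal t \<longrightarrow> (t, t0, x0, u) \<notin> A)
      \<and> (tm < \<infinity> \<longrightarrow> (\<forall>M>0. \<exists>t\<ge>t0. ereal t < tm \<and> norm (phi t t0 x0 u) > M)))"

definition time_invariant where
  "time_invariant Uc A phi \<longleftrightarrow>
    (\<forall>s\<ge>0. \<forall>r\<ge>0. \<forall>x. \<forall>u\<in>Uc. \<forall>v\<in>Uc. (\<forall>\<tau>\<ge>0. u (s + \<tau>) = v (r + \<tau>)) \<longrightarrow>
      (\<forall>\<tau>\<ge>0. ((s + \<tau>, s, x, u) \<in> A \<longleftrightarrow> (r + \<tau>, r, x, v) \<in> A)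
        \<and> ((s + \<tau>, s, x, u) \<in> A \<longrightarrow> phi (s + \<tau>) s x u = phi (r + \<tau>) r x v)))"

definition shift :: "real \<Rightarrow> (real \<Rightarrow> 'u::real_normed_vector) \<Rightarrow> real \<Rightarrow> 'u" where
  "shift s u = (\<lambda>\<tau>. if \<tau> \<ge> 0 then u (\<tau> + s) else 0)"

definition equilibrium where
  "equilibrium A phi x0 \<longleftrightarrow> (\<forall>t\<ge>0. (t, 0, x0, \<lambda>_. 0) \<in> A \<and> phi t 0 x0 (\<lambda>_. 0) = x0)"

text \<open>The radii range over \<^typ>\<open>ereal\<close> so that the local and the global notions are instances of the
  same estimate. The estimate includes that the trajectory exists for all times.\<close>

definition ISS_within where
  "ISS_within \<rho>x \<rho>u Uc normU A phi \<longleftrightarrow>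
    (\<exists>\<beta> \<gamma>. class_KL \<beta> \<and> class_K \<gamma> \<and>
      (\<forall>x0. \<forall>t\<ge>0. \<forall>u\<in>Uc. ereal (norm x0) \<le> \<rho>x \<and> ereal (normU u) \<le> \<rho>u \<longrightarrow>
        (t, 0, x0, u) \<in> A \<and> norm (phi t 0 x0 u) \<le> \<beta> (norm x0) t + \<gamma> (normU u)))"

definition LISS where
  "LISS Uc normU A phi \<longleftrightarrow>
    (\<exists>\<rho>x>0. \<exists>\<rho>u>0. ISS_within (ereal \<rho>x) (ereal \<rho>u) Uc normU A phi)"

definition ISS where
  "ISS Uc normU A phi \<longleftrightarrow> ISS_within \<infinity> \<infinity> Uc normU A phi"

definition Lyap_deriv where
  "Lyap_deriv phi V u x =
    Limsup (at_right 0) (\<lambda>t. ereal ((1 / t) * (V (phi t 0 x u) - V x)))"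

definition ISS_Lyapunov_within where
  "ISS_Lyapunov_within \<rho>x \<rho>u D Uc normU phi V \<longleftrightarrow>
    continuous_on D V \<and> (\<forall>x\<in>D. V x \<ge> 0) \<and> 0 \<in> interior D \<and>
    (\<exists>\<psi>1 \<psi>2 \<eta> \<alpha>. class_Kinf \<psi>1 \<and> class_Kinf \<psi>2 \<and> class_K \<eta> \<and> pos_def_fun \<alpha> \<and>
      (\<forall>x\<in>D. \<psi>1 (norm x) \<le> V x \<and> V x \<le> \<psi>2 (norm x)) \<and>
      (\<forall>x. \<forall>u\<in>Uc. ereal (norm x) \<le> \<rho>x \<and> ereal (normU u) \<le> \<rho>u \<longrightarrow>
        norm x \<ge> \<eta> (normU u) \<longrightarrow> Lyap_deriv phi V u x \<le> ereal (- \<alpha> (norm x))))"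

text \<open>Values of \<open>V\<close> outside \<open>D\<close> are irrelevant: since \<open>0 \<in> interior D\<close> and trajectories are
  continuous, they do not enter the decay condition once \<open>\<rho>x\<close> is small enough.\<close>

definition local_ISS_Lyapunov where
  "local_ISS_Lyapunov D Uc normU phi V \<longleftrightarrow>
    (\<exists>\<rho>x>0. \<exists>\<rho>u>0. ISS_Lyapunov_within (ereal \<rho>x) (ereal \<rho>u) D Uc normU phi V)"

definition ISS_Lyapunov where
  "ISS_Lyapunov Uc normU phi V \<longleftrightarrow> ISS_Lyapunov_within \<infinity> \<infinity> UNIV Uc normU phi V"

end

(* The Lyapunov function is compared, along a trajectory, with a scalar decay equation. As long as
   V is at least c = \<psi>2 (\<eta> (normU u)), the decay condition applies (also after time shifts, since
   shifting does not increase the norm of the input), so the upper Dini derivative of V is at most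
   - a V for a continuous rate a with 0 < a v \<le> v for v > 0. Hence {V \<le> c} is forward invariant
   within the region where the decay condition holds, and before it is reached V stays below the
   solution of w' = - a w. The bound a v \<le> v makes this solution positive for all times and gives
   it explicitly as the flow of a translation in an expanding coordinate P (ln w). A trajectory
   starting low enough cannot cross the sphere of radius r, where V \<ge> \<psi>1 r, so it is bounded and
   BIC yields existence for all times. *)

theory Submission
  imports Defs
begin

section \<open>Growth estimates from one-sided Dini bounds\<close>

text \<open>For fixed slope \<open>e\<close>, the times at which
  \<open>f t \<le> f a + e * (t - a)\<close> form a closed set. Its supremum must be
  \<open>b\<close>, because at an earlier time the Dini bound would push the inequality further to
  the right. Letting \<open>e\<close> tend to 0 removes the slope.\<close>

lemma dini_nonpos_imp_le:
  fixes f :: "real \<Rightarrow> real"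
  assumes ab: "a \<le> b" and cont: "continuous_on {a..b} f"
    and dini: "\<And>t e. a \<le> t \<Longrightarrow> t < b \<Longrightarrow> e > 0 \<Longrightarrow> eventually (\<lambda>h. f (t + h) \<le> f t + e * h) (at_right 0)"
  shows "f b \<le> f a"
proof -
  have *: "f b \<le> f a + e * (b - a)" if e: "e > 0" for e
  proof -
    define S where "S = {a..b} \<inter> (\<lambda>t. f t - e * (t - a)) -` {..f a}"
    have "closed S"
      unfolding S_def by (intro continuous_closed_preimage continuous_intros cont)
    moreover have "a \<in> S" "bdd_above S" using ab by (auto simp: S_def intro: bdd_aboveI[of _ b])
    ultimately have SupS: "Sup S \<in> S" by (intro closed_contains_Sup) auto
    define s where "s = Sup S"
    have s: "a \<le> s" "s \<le> b" "f s \<le> f a + e * (s - a)" using SupS by (auto simp: s_def S_def)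
    have "s = b"
    proof (rule ccontr)
      assume "s \<noteq> b"
      with s have sb: "s < b" by simp
      have "eventually (\<lambda>h. f (s + h) \<le> f s + e * h) (at_right 0)"
        using dini s sb e by blast
      moreover have "eventually (\<lambda>h. 0 < h \<and> h < b - s) (at_right 0)"
        using sb by (auto simp: eventually_at_right_field intro!: exI[of _ "b - s"])
      ultimately have "eventually (\<lambda>h. f (s + h) \<le> f s + e * h \<and> 0 < h \<and> h < b - s) (at_right 0)"
        by eventually_elim auto
      then obtain h where h: "f (s + h) \<le> f s + e * h" "0 < h" "h < b - s"
        using eventually_happens'[OF trivial_limit_at_right_real] by blast
      have "s + h \<in> S" using s h by (auto simp: S_def algebra_simps)
      then have "s + h \<le> s" unfolding s_def using \<open>bdd_above S\<close> by (rule cSup_upper)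
      then show False using h by simp
    qed
    then show ?thesis using s by simp
  qed
  show ?thesis
  proof (rule field_le_epsilon)
    fix e :: real assume e: "e > 0"
    show "f b \<le> f a + e"
    proof -
      \<comment> \<open>The added 1 keeps the denominator positive when
        \<open>a = b\<close>.\<close>
      have "e / (b - a + 1) > 0" using e ab by (simp add: field_simps)
      from *[OF this] have "f b \<le> f a + e / (b - a + 1) * (b - a)" .
      also have "e / (b - a + 1) * (b - a) \<le> e" using e ab by (simp add: field_simps)
      finally show ?thesis by simp
    qed
  qed
qed

text \<open>If \<open>y b\<close> exceeded \<open>m\<close>, there would be a last time
  \<open>s\<close> with \<open>y s \<le> m\<close>. From \<open>s\<close> on, \<open>y\<close> is at
  least \<open>m\<close>, hence at least \<open>c\<close>, so the Dini bound is available on all of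
  \<open>{s..b}\<close> and forbids growth from \<open>y s\<close> to \<open>y b\<close>.\<close>

lemma dini_sublevel_invariant:
  fixes y :: "real \<Rightarrow> real"
  assumes ab: "a \<le> b" and cont: "continuous_on {a..b} y"
    and dini: "\<And>t e. a \<le> t \<Longrightarrow> t < b \<Longrightarrow> c \<le> y t \<Longrightarrow> e > 0 \<Longrightarrow>
      eventually (\<lambda>h. y (t + h) \<le> y t + e * h) (at_right 0)"
    and m: "c \<le> m" "y a \<le> m"
  shows "y b \<le> m"
proof (rule ccontr)
  assume "\<not> y b \<le> m"
  then have yb: "m < y b" by simp
  define S where "S = {a..b} \<inter> y -` {..m}"
  have "closed S"
    unfolding S_def by (intro continuous_closed_preimage cont) auto
  moreover have "a \<in> S" and bdd: "bdd_above S" using ab m by (auto simp: S_def intro: bdd_aboveI[of _ b])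
  ultimately have SupS: "Sup S \<in> S" by (intro closed_contains_Sup) auto
  define s where "s = Sup S"
  have s: "a \<le> s" "s \<le> b" "y s \<le> m" using SupS by (auto simp: s_def S_def)
  have gt: "m < y t" if "s < t" "t \<le> b" for t
  proof (rule ccontr)
    assume "\<not> m < y t"
    then have "t \<in> S" using that s by (auto simp: S_def)
    then have "t \<le> s" unfolding s_def using bdd by (rule cSup_upper)
    then show False using that by simp
  qed
  have "s < b" using s yb by (cases "s = b") auto
  \<comment> \<open>The Dini bound is also needed at \<open>s\<close> itself. If
    \<open>y s < m\<close>, the midpoint of \<open>y s\<close> and \<open>m\<close> would be
    attained after \<open>s\<close>, contradicting the choice of \<open>s\<close>.\<close>
  have ys: "m \<le> y s"
  proof (rule ccontr)
    assume "\<not> m \<le> y s"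
    then obtain t where "s \<le> t" "t \<le> b" "y t = (y s + m) / 2"
      using IVT'[of y s "(y s + m) / 2" b] yb s continuous_on_subset[OF cont, of "{s..b}"] by auto
    with \<open>\<not> m \<le> y s\<close> gt[of t] show False by (cases "t = s") auto
  qed
  have "y b \<le> y s"
  proof (rule dini_nonpos_imp_le[of s b y])
    show "continuous_on {s..b} y" using continuous_on_subset[OF cont, of "{s..b}"] s by auto
    fix t e :: real assume t: "s \<le> t" "t < b" "e > 0"
    then have "m \<le> y t" using gt[of t] ys by (cases "t = s") auto
    then show "eventually (\<lambda>h. y (t + h) \<le> y t + e * h) (at_right 0)"
      using dini[of t e] t s m by simp
  qed (use s in simp)
  with yb s show False by simp
qed

lemma strict_mono_inv_continuous:
  fixes f :: "real \<Rightarrow> real"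
  assumes mono: "strict_mono f" and surj: "surj f"
  shows "strict_mono (inv f)" and "continuous_on UNIV (inv f)"
proof -
  have inj: "inj f" using mono by (rule strict_mono_imp_inj_on)
  show sm: "strict_mono (inv f)"
  proof (rule strict_monoI)
    fix x y :: real assume "x < y"
    then have "f (inv f x) < f (inv f y)" using surj by (simp add: surj_f_inv_f)
    then show "inv f x < inv f y" using mono by (simp add: strict_mono_less)
  qed
  \<comment> \<open>An increasing map whose image is the whole line has no jumps, which gives
    continuity.\<close>
  have "inv f ` UNIV = UNIV" using inj by (simp add: inj_imp_surj_inv)
  then show "continuous_on UNIV (inv f)"
    using sm by (intro continuous_onI_mono) (auto simp: strict_mono_less_eq)
qed

section \<open>Comparison functions\<close>

lemma class_KD:
  assumes "class_K g"
  shows "continuous_on {0..} g" "g 0 = 0"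
    and "\<And>x y. 0 \<le> x \<Longrightarrow> x < y \<Longrightarrow> g x < g y"
    and "\<And>x y. 0 \<le> x \<Longrightarrow> x \<le> y \<Longrightarrow> g x \<le> g y"
    and "\<And>x. 0 \<le> x \<Longrightarrow> 0 \<le> g x"
    and "\<And>x. 0 < x \<Longrightarrow> 0 < g x"
proof -
  show "continuous_on {0..} g" and g0: "g 0 = 0" using assms by (auto simp: class_K_def)
  show lt: "g x < g y" if "0 \<le> x" "x < y" for x y
    using assms that by (auto simp: class_K_def strict_mono_on_def)
  show "g x \<le> g y" if "0 \<le> x" "x \<le> y" for x y
    using lt[of x y] that by (cases "x = y") auto
  show "0 \<le> g x" if "0 \<le> x" for x using lt[of 0 x] that g0 by (cases "x = 0") auto
  show "0 < g x" if "0 < x" for x using lt[of 0 x] that g0 by auto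
qed

lemma class_K_compose:
  assumes f: "class_K f" and g: "class_K g"
  shows "class_K (\<lambda>x. f (g x))"
  unfolding class_K_def strict_mono_on_def
  using class_KD[OF f] class_KD[OF g]
  by (auto intro!: continuous_on_compose2[of "{0..}" f])

lemma class_K_compose_L:
  assumes f: "class_K f" and g: "class_L g"
  shows "class_L (\<lambda>x. f (g x))"
proof -
  have lim: "(g \<longlongrightarrow> 0) at_top" and dec: "\<And>x y. 0 \<le> x \<Longrightarrow> x < y \<Longrightarrow> g y < g x"
    and cont: "continuous_on {0..} g"
    using g by (auto simp: class_L_def monotone_on_def)
  \<comment> \<open>Every value of a decreasing function bounds its later values, hence also the
    limit 0.\<close>
  have nonneg: "0 \<le> g x" if "0 \<le> x" for x
  proof (rule tendsto_upperbound[OF lim])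
    show "eventually (\<lambda>t. g t \<le> g x) at_top"
      using eventually_gt_at_top[of x] by eventually_elim (use dec that in force)
  qed simp
  have "((\<lambda>x. f (g x)) \<longlongrightarrow> f 0) at_top"
  proof (rule continuous_on_tendsto_compose[OF class_KD(1)[OF f] lim])
    show "eventually (\<lambda>x. g x \<in> {0..}) at_top"
      using eventually_ge_at_top[of 0] by eventually_elim (use nonneg in auto)
  qed simp
  moreover have "continuous_on {0..} (\<lambda>x. f (g x))"
    using nonneg by (intro continuous_on_compose2[OF class_KD(1)[OF f] cont]) auto
  ultimately show ?thesis
    using class_KD[OF f] dec nonneg by (auto simp: class_L_def monotone_on_def)
qed

lemma class_K_small:
  assumes g: "class_K g" and e: "e > 0"
  obtains d where "d > 0" "g d < e"
proof -
  have "(g \<longlongrightarrow> g 0) (at 0 within {0..})"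
    using class_KD(1)[OF g] by (simp add: continuous_on_def)
  then have "eventually (\<lambda>x. g x < e) (at_right 0)"
    using order_tendstoD(2)[of g "g 0" _ e] class_KD(2)[OF g] e
    by (auto simp: at_within_Ici_at_right)
  then have "eventually (\<lambda>x. g x < e \<and> x > 0) (at_right 0)"
    using eventually_at_right_less[of "0::real"] by eventually_elim auto
  then show ?thesis
    using eventually_happens'[OF trivial_limit_at_right_real] that by blast
qed

lemma class_Kinf_large:
  assumes g: "class_Kinf g"
  obtains r where "r > 0" "g r > M"
proof -
  have K: "class_K g" using g by (simp add: class_Kinf_def)
  \<comment> \<open>Exceeding \<open>max M 0\<close> rather than \<open>M\<close> excludes
    \<open>r = 0\<close>, where \<open>g\<close> vanishes.\<close>
  obtain r where "r \<ge> 0" "g r > max M 0"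
    using g unfolding class_Kinf_def bdd_above_def
    by (metis (no_types, lifting) atLeast_iff imageE not_le)
  moreover from this have "r \<noteq> 0" using class_KD(2)[OF K] by auto
  ultimately show ?thesis using that[of r] by auto
qed

lemma class_Kinf_inverse:
  assumes g: "class_Kinf g"
  obtains k where "class_K k" "\<And>x. 0 \<le> x \<Longrightarrow> k (g x) = x"
proof -
  have K: "class_K g" using g by (simp add: class_Kinf_def)
  \<comment> \<open>Extending \<open>g\<close> by the identity to negative arguments makes it an
    increasing bijection of the line, whose inverse restricts to the required
    \<open>k\<close>.\<close>
  define f where "f x = (if x < 0 then x else g x)" for x
  have mono: "strict_mono f"
    using class_KD[OF K] by (intro strict_monoI) (auto simp: f_def intro: less_le_trans)
  have "\<exists>x. f x = v" for v
  proof (cases "v < 0")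
    case False
    obtain r where r: "r > 0" "g r > v" using class_Kinf_large[OF g] .
    obtain x where "0 \<le> x" "g x = v"
      using IVT'[of g 0 v r] False r class_KD(2)[OF K]
        continuous_on_subset[OF class_KD(1)[OF K], of "{0..r}"] by auto
    then show ?thesis by (intro exI[of _ x]) (simp add: f_def)
  qed (auto simp: f_def)
  then have surj: "surj f" by (metis surjI)
  note inv = strict_mono_inv_continuous[OF mono surj]
  have left_inv: "inv f (g x) = x" if "0 \<le> x" for x
    using inv_f_f[OF strict_mono_imp_inj_on[OF mono], of x] that by (simp add: f_def)
  have "class_K (inv f)"
    unfolding class_K_def using inv left_inv[of 0] class_KD(2)[OF K]
    by (auto intro: continuous_on_subset simp: strict_mono_on_def strict_mono_def)
  then show ?thesis by (rule that) (rule left_inv)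
qed

section \<open>A continuous decay rate in terms of the Lyapunov value\<close>

text \<open>Replacing the worst case of \<open>\<alpha> (norm x)\<close> over all \<open>x\<close> with \<open>V x = v\<close> by an infimal convolution
  makes the rate 1-Lipschitz in \<open>v\<close>; the pair \<open>(0, 0)\<close> yields the bound by \<open>v\<close>.\<close>

lemma decay_rate_exists:
  assumes p1: "class_Kinf \<psi>1" and p2: "class_Kinf \<psi>2" and al: "pos_def_fun \<alpha>"
  obtains a :: "real \<Rightarrow> real" where "continuous_on UNIV a"
    "\<And>v. 0 \<le> v \<Longrightarrow> 0 \<le> a v" "\<And>v. 0 < v \<Longrightarrow> 0 < a v" "\<And>v. 0 \<le> v \<Longrightarrow> a v \<le> v"
    "\<And>s w. 0 \<le> s \<Longrightarrow> \<psi>1 s \<le> w \<Longrightarrow> w \<le> \<psi>2 s \<Longrightarrow> a w \<le> \<alpha> s"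
proof -
  have K1: "class_K \<psi>1" and K2: "class_K \<psi>2" using p1 p2 by (auto simp: class_Kinf_def)
  have al_nonneg: "0 \<le> \<alpha> s" if "0 \<le> s" for s
    using al that by (cases "s = 0") (auto simp: pos_def_fun_def less_imp_le)
  \<comment> \<open>\<open>S\<close> contains every pair \<open>(norm x, V x)\<close> that the
    bounds on \<open>V\<close> permit, so the infimum covers all states at once.\<close>
  define S where "S = {(s, w). 0 \<le> s \<and> \<psi>1 s \<le> w \<and> w \<le> \<psi>2 s}"
  define a where "a v = (INF p\<in>S. \<alpha> (fst p) + \<bar>v - snd p\<bar>)" for v
  have S0: "(0, 0) \<in> S" using class_KD(2)[OF K1] class_KD(2)[OF K2] by (simp add: S_def)
  have bdd: "bdd_below ((\<lambda>p. \<alpha> (fst p) + \<bar>v - snd p\<bar>) ` S)" for v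
  proof (rule bdd_belowI2)
    fix p assume "p \<in> S"
    then have "0 \<le> \<alpha> (fst p)" using al_nonneg[of "fst p"] by (simp add: S_def case_prod_beta)
    then show "0 \<le> \<alpha> (fst p) + \<bar>v - snd p\<bar>" by simp
  qed
  have upper: "a v \<le> \<alpha> s + \<bar>v - w\<bar>" if "(s, w) \<in> S" for v s w
    unfolding a_def using cINF_lower[OF bdd that, of v] by simp
  have lower: "m \<le> a v" if "\<And>s w. (s, w) \<in> S \<Longrightarrow> m \<le> \<alpha> s + \<bar>v - w\<bar>" for m v
    unfolding a_def
  proof (rule cINF_greatest)
    fix p assume "p \<in> S"
    then show "m \<le> \<alpha> (fst p) + \<bar>v - snd p\<bar>" using that[of "fst p" "snd p"] by simp
  qed (use S0 in blast)
  have lip: "a v \<le> a w + \<bar>v - w\<bar>" for v w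
  proof -
    have "a v - \<bar>v - w\<bar> \<le> a w"
    proof (rule lower)
      fix s x assume "(s, x) \<in> S"
      from upper[OF this, of v] show "a v - \<bar>v - w\<bar> \<le> \<alpha> s + \<bar>w - x\<bar>" by arith
    qed
    then show ?thesis by simp
  qed
  have "continuous_on UNIV a"
    unfolding continuous_on_iff dist_real_def
  proof (intro ballI allI impI)
    fix x e :: real assume "0 < e"
    moreover have "\<bar>a x' - a x\<bar> \<le> \<bar>x' - x\<bar>" for x' using lip[of x x'] lip[of x' x] by arith
    ultimately show "\<exists>d>0. \<forall>x'\<in>UNIV. \<bar>x' - x\<bar> < d \<longrightarrow> \<bar>a x' - a x\<bar> < e"
      by (meson le_less_trans)
  qed
  moreover have "0 \<le> a v" for v
  proof (rule lower)
    fix s w assume "(s, w) \<in> S"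
    then show "0 \<le> \<alpha> s + \<bar>v - w\<bar>" using al_nonneg[of s] by (simp add: S_def)
  qed
  \<comment> \<open>A pair with \<open>w\<close> at distance at least \<open>v / 2\<close> from
    \<open>v\<close> contributes at least \<open>v / 2\<close>. Any other pair has
    \<open>v / 2 < w < 2 * v\<close>, which confines \<open>s\<close> to \<open>{l..r}\<close>;
    there the continuous function \<open>\<alpha>\<close> has a positive minimum. If
    \<open>l > r\<close>, this range is empty and any positive \<open>m\<close> serves.\<close>
  moreover have "0 < a v" if v: "0 < v" for v
  proof -
    obtain l where l: "l > 0" "\<psi>2 l < v / 2" using class_K_small[OF K2, of "v / 2"] v by auto
    obtain r where r: "r > 0" "\<psi>1 r > 2 * v" using class_Kinf_large[OF p1] .
    obtain m where m: "m > 0" "\<And>s. s \<in> {l..r} \<Longrightarrow> m \<le> \<alpha> s"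
    proof (cases "l \<le> r")
      case True
      have "continuous_on {l..r} \<alpha>"
        using al l by (auto simp: pos_def_fun_def intro: continuous_on_subset)
      then obtain x where "x \<in> {l..r}" "\<forall>s\<in>{l..r}. \<alpha> x \<le> \<alpha> s"
        using continuous_attains_inf[of "{l..r}" \<alpha>] True by auto
      then show ?thesis using that[of "\<alpha> x"] al l by (auto simp: pos_def_fun_def)
    qed (use that[of 1] in auto)
    have "min m (v / 2) \<le> a v"
    proof (rule lower)
      fix s w assume sw: "(s, w) \<in> S"
      show "min m (v / 2) \<le> \<alpha> s + \<bar>v - w\<bar>"
      proof (cases "\<bar>v - w\<bar> \<ge> v / 2")
        case True
        then have "min m (v / 2) \<le> \<bar>v - w\<bar>" by linarith
        then show ?thesis using al_nonneg[of s] sw by (simp add: S_def)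
      next
        case False
        then have "v / 2 < w" "w < 2 * v" using v by linarith+
        then have "\<psi>2 l < \<psi>2 s" "\<psi>1 s < \<psi>1 r" using sw l r by (auto simp: S_def)
        then have "l \<le> s" "s \<le> r"
          using class_KD(4)[OF K2, of s l] class_KD(4)[OF K1, of r s] sw l r
          by (auto simp: S_def intro!: leI)
        then have "min m (v / 2) \<le> \<alpha> s" using m(2)[of s] by (simp add: min.coboundedI1)
        then show ?thesis by simp
      qed
    qed
    then show ?thesis using m v by auto
  qed
  moreover have "a v \<le> v" if "0 \<le> v" for v
    using upper[OF S0, of v] al that by (auto simp: pos_def_fun_def)
  moreover have "a w \<le> \<alpha> s" if "0 \<le> s" "\<psi>1 s \<le> w" "w \<le> \<psi>2 s" for s w
    using upper[of s w w] that by (auto simp: S_def)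
  ultimately show ?thesis using that by blast
qed

section \<open>The scalar comparison principle\<close>

text \<open>For \<open>P' s = exp s / a (exp s)\<close>, the function \<open>decay_bound P r\<close> is the solution of
  \<open>w' = - a w\<close> with \<open>w 0 = r\<close>, in logarithmic coordinates.\<close>

definition decay_bound :: "(real \<Rightarrow> real) \<Rightarrow> real \<Rightarrow> real \<Rightarrow> real" where
  "decay_bound P r t = (if r \<le> 0 then 0 else exp (inv P (P (ln r) - t)))"

text \<open>Along \<open>w' = - a w\<close> with \<open>w = exp s\<close>, the quantity
  \<open>P s\<close> decreases at unit speed; this is why the flow becomes a translation in this
  coordinate.\<close>

locale decay_rate =
  fixes a P :: "real \<Rightarrow> real"
  assumes a_nonneg: "0 \<le> v \<Longrightarrow> 0 \<le> a v"
    and a_pos: "0 < v \<Longrightarrow> 0 < a v"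
    and a_le: "0 \<le> v \<Longrightarrow> a v \<le> v"
    and P_deriv: "(P has_real_derivative exp s / a (exp s)) (at s)"
begin

text \<open>The bound \<open>a v \<le> v\<close> makes the derivative of \<open>P\<close> at least
  1. Hence \<open>P\<close> is a bijection of the line, and the translated point always has a
  preimage: the solution never reaches 0 in finite time.\<close>

lemma P_expanding: "s \<le> t \<Longrightarrow> t - s \<le> P t - P s"
proof -
  assume "s \<le> t"
  have "P s - s \<le> P t - t"
  proof (rule DERIV_nonneg_imp_nondecreasing[OF \<open>s \<le> t\<close>])
    fix x
    have "1 \<le> exp x / a (exp x)" using a_le[of "exp x"] a_pos[of "exp x"] by simp
    then show "\<exists>y. ((\<lambda>s. P s - s) has_real_derivative y) (at x) \<and> 0 \<le> y"
      by (intro exI[of _ "exp x / a (exp x) - 1"]) (auto intro!: derivative_eq_intros P_deriv)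
  qed
  then show ?thesis by simp
qed

lemma P_cont: "continuous_on UNIV P"
  using P_deriv by (intro continuous_at_imp_continuous_on) (auto intro: DERIV_isCont)

lemma P_mono: "strict_mono P"
  using P_expanding by (intro strict_monoI) (smt (verit))

lemma P_surj: "surj P"
proof -
  have "\<exists>x. P x = v" for v
  proof -
    define r where "r = \<bar>v - P 0\<bar>"
    have "P (- r) \<le> v" "v \<le> P r"
      using P_expanding[of "- r" 0] P_expanding[of 0 r] by (auto simp: r_def)
    then show ?thesis
      using IVT'[of P "- r" v r] continuous_on_subset[OF P_cont] by (auto simp: r_def)
  qed
  then show ?thesis by (metis surjI)
qed

lemmas P_inv = strict_mono_inv_continuous[OF P_mono P_surj]

lemma inv_P_P [simp]: "inv P (P x) = x"
  using P_mono by (simp add: strict_mono_imp_inj_on)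

lemma decay_bound_0: "0 \<le> r \<Longrightarrow> decay_bound P r 0 = r"
  by (simp add: decay_bound_def)

lemma decay_bound_less: "0 \<le> r \<Longrightarrow> r < s \<Longrightarrow> decay_bound P r t < decay_bound P s t"
  using P_mono P_inv(1) by (auto simp: decay_bound_def strict_mono_less)

lemma decay_bound_less_time: "0 < r \<Longrightarrow> s < t \<Longrightarrow> decay_bound P r t < decay_bound P r s"
  using P_inv(1) by (auto simp: decay_bound_def strict_mono_less)

lemma decay_bound_le: "0 \<le> r \<Longrightarrow> 0 \<le> t \<Longrightarrow> decay_bound P r t \<le> r"
  using decay_bound_less_time[of r 0 t] decay_bound_0[of r]
  by (cases "r = 0"; cases "t = 0") (auto simp: decay_bound_def)

lemma decay_bound_nonneg: "0 \<le> decay_bound P r t"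
  by (simp add: decay_bound_def)

lemma class_K_decay_bound:
  assumes "0 \<le> t"
  shows "class_K (\<lambda>r. decay_bound P r t)"
proof -
  have pos: "continuous_on {0<..} (\<lambda>r. decay_bound P r t)"
  proof -
    have "continuous_on {0<..} (\<lambda>r. exp (inv P (P (ln r) - t)))"
      by (intro continuous_intros continuous_on_compose2[OF P_inv(2)]
          continuous_on_compose2[OF P_cont]) auto
    then show ?thesis
      by (rule continuous_on_cong[THEN iffD1, rotated -1]) (auto simp: decay_bound_def)
  qed
  have "continuous_on {0..} (\<lambda>r. decay_bound P r t)"
    unfolding continuous_on_eq_continuous_within
  proof
    fix x :: real assume "x \<in> {0..}"
    show "continuous (at x within {0..}) (\<lambda>r. decay_bound P r t)"
    proof (cases "x = 0")
      case False
      then have "isCont (\<lambda>r. decay_bound P r t) x"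
        using pos \<open>x \<in> {0..}\<close> by (auto simp: continuous_on_eq_continuous_at)
      then show ?thesis by (rule continuous_at_imp_continuous_at_within)
    next
      case True
      \<comment> \<open>The logarithmic formula breaks down at \<open>r = 0\<close>, so continuity
        there comes from squeezing the bound between 0 and \<open>r\<close>.\<close>
      have "((\<lambda>r. decay_bound P r t) \<longlongrightarrow> 0) (at 0 within {0..})"
      proof (rule tendsto_sandwich[of "\<lambda>_. 0" _ _ "\<lambda>r. r"])
        show "eventually (\<lambda>r. decay_bound P r t \<le> r) (at 0 within {0..})"
          using decay_bound_le[OF _ assms] by (auto simp: eventually_at intro!: exI[of _ 1])
      qed (auto simp: decay_bound_nonneg intro!: tendsto_eq_intros)
      then show ?thesis using True by (simp add: continuous_within decay_bound_def)
    qed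
  qed
  then show ?thesis
    using decay_bound_less
    by (auto simp: class_K_def strict_mono_on_def decay_bound_def[of _ 0])
qed

lemma class_L_decay_bound:
  assumes r: "0 < r"
  shows "class_L (decay_bound P r)"
proof -
  have eq: "decay_bound P r = (\<lambda>t. exp (inv P (P (ln r) - t)))"
    using r by (auto simp: decay_bound_def)
  have cont: "continuous_on {0..} (decay_bound P r)"
    unfolding eq by (intro continuous_intros continuous_on_compose2[OF P_inv(2)]) auto
  have "filterlim (inv P) at_bot at_bot"
    unfolding filterlim_at_bot
  proof
    fix Z
    have "inv P x \<le> Z" if "x \<le> P Z" for x
      using that P_inv(1) by (metis inv_P_P strict_mono_less_eq)
    then show "eventually (\<lambda>x. inv P x \<le> Z) at_bot"
      using eventually_le_at_bot[of "P Z"] by (rule eventually_mono[rotated])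
  qed
  moreover have "filterlim (\<lambda>t. P (ln r) - t) at_bot at_top"
    unfolding filterlim_at_bot
  proof
    fix Z
    show "eventually (\<lambda>t. P (ln r) - t \<le> Z) at_top"
      using eventually_ge_at_top[of "P (ln r) - Z"] by eventually_elim simp
  qed
  ultimately have "(decay_bound P r \<longlongrightarrow> 0) at_top"
    unfolding eq by (rule filterlim_compose[OF exp_at_bot filterlim_compose])
  with cont show ?thesis
    using decay_bound_less_time[OF r] by (auto simp: class_L_def monotone_on_def)
qed

text \<open>Unless \<open>y T \<le> c\<close>, invariance of the sublevel set keeps \<open>y\<close>
  above \<open>c\<close> throughout. Then \<open>P (ln (y t)) + t\<close> is defined, and the chain
  rule multiplies the slope \<open>- a (y t)\<close> by \<open>1 / a (y t)\<close>, so its Dini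
  derivative is at most 0. Inverting \<open>P\<close> and \<open>ln\<close> gives the bound.\<close>

lemma dini_comparison:
  assumes T: "0 \<le> T" and cont: "continuous_on {0..T} y" and c: "0 \<le> c"
    and dini: "\<And>t e. 0 \<le> t \<Longrightarrow> t < T \<Longrightarrow> c \<le> y t \<Longrightarrow> 0 < e \<Longrightarrow>
      eventually (\<lambda>h. y (t + h) \<le> y t + h * (e - a (y t))) (at_right 0)"
  shows "y T \<le> max c (decay_bound P (y 0) T)"
proof (cases "y T \<le> c")
  case False
  have dini0: "eventually (\<lambda>h. y (t + h) \<le> y t + e * h) (at_right 0)"
    if "0 \<le> t" "t < T" "c \<le> y t" "0 < e" for t e
    using dini[OF that] eventually_at_right_less[of "0::real"]
  proof eventually_elim
    case (elim h)
    have "h * (e - a (y t)) \<le> h * e"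
      using elim a_nonneg[of "y t"] that c by (intro mult_left_mono) auto
    with elim(1) show ?case unfolding mult.commute[of e h] by linarith
  qed
  have gt: "c < y t" if "0 \<le> t" "t \<le> T" for t
  proof (rule ccontr)
    assume "\<not> c < y t"
    then have "y T \<le> c"
      using that dini0 continuous_on_subset[OF cont, of "{t..T}"]
      by (intro dini_sublevel_invariant[of t T y c c]) auto
    with False show False by simp
  qed
  have pos: "0 < y t" if "0 \<le> t" "t \<le> T" for t using gt[OF that] c by simp
  define g where "g w = P (ln w)" for w
  have g_mono: "g v \<le> g w" if "0 < v" "v \<le> w" for v w
    using that P_mono by (simp add: g_def strict_mono_less_eq)
  have g_deriv: "(g has_real_derivative 1 / a v) (at v)" if "0 < v" for v
  proof -
    have "(g has_real_derivative exp (ln v) / a (exp (ln v)) * (1 / v)) (at v)"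
      unfolding g_def using that
      by (intro DERIV_chain2[OF P_deriv]) (auto intro!: derivative_eq_intros)
    then show ?thesis using that by simp
  qed
  have "g (y T) + T \<le> g (y 0) + 0"
  proof (rule dini_nonpos_imp_le[OF T, of "\<lambda>t. g (y t) + t"])
    show "continuous_on {0..T} (\<lambda>t. g (y t) + t)"
      unfolding g_def using pos
      by (intro continuous_intros continuous_on_compose2[OF P_cont] cont) (auto simp: less_le)
    fix t e :: real assume t: "0 \<le> t" "t < T" and e: "0 < e"
    define v where "v = y t"
    have v: "0 < v" "0 < a v" using pos[of t] t a_pos by (auto simp: v_def)
    \<comment> \<open>This choice gives the auxiliary function \<open>k\<close> the slope
      \<open>e / 2 - 1\<close> at 0. The gap to \<open>e - 1\<close> turns the derivative into an
      inequality for small \<open>h\<close>, and since \<open>g\<close> is increasing,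
      \<open>k h\<close> dominates \<open>g (y (t + h))\<close>.\<close>
    define e' where "e' = e * a v / 2"
    define k where "k h = g (v + h * (e' - a v))" for h
    have "(k has_real_derivative (1 / a v) * (e' - a v)) (at 0)"
      unfolding k_def using v
      by (intro DERIV_chain2[of g]) (auto intro!: g_deriv derivative_eq_intros)
    also have "(1 / a v) * (e' - a v) = e / 2 - 1" using v by (simp add: e'_def field_simps)
    finally have "((\<lambda>h. (k h - k 0) / h) \<longlongrightarrow> e / 2 - 1) (at 0)"
      by (simp add: has_field_derivative_iff)
    then have "((\<lambda>h. (k h - k 0) / h) \<longlongrightarrow> e / 2 - 1) (at_right 0)"
      by (rule filterlim_mono) (auto intro: at_le)
    then have ev1: "eventually (\<lambda>h. (k h - k 0) / h < e - 1) (at_right 0)"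
      using e by (intro order_tendstoD(2)) auto
    have ev2: "eventually (\<lambda>h. y (t + h) \<le> y t + h * (e' - a (y t))) (at_right 0)"
      using dini[of t e'] t e v gt[of t] by (auto simp: e'_def)
    have ev3: "eventually (\<lambda>h. 0 < h \<and> h < T - t) (at_right 0)"
      using t by (auto simp: eventually_at_right_field intro!: exI[of _ "T - t"])
    show "eventually (\<lambda>h. g (y (t + h)) + (t + h) \<le> g (y t) + t + e * h) (at_right 0)"
      using ev1 ev2 ev3
    proof eventually_elim
      case (elim h)
      have "g (y (t + h)) \<le> k h"
        unfolding k_def using elim pos[of "t + h"] t by (intro g_mono) (auto simp: v_def)
      moreover have "k h - k 0 \<le> h * (e - 1)"
        using elim by (simp add: field_simps)
      moreover have "k 0 = g (y t)" by (simp add: k_def v_def)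
      ultimately show ?case by (simp add: algebra_simps)
    qed
  qed
  then have "P (ln (y T)) \<le> P (ln (y 0)) - T" by (simp add: g_def)
  then have "inv P (P (ln (y T))) \<le> inv P (P (ln (y 0)) - T)"
    using P_inv(1) by (simp only: strict_mono_less_eq)
  then have "ln (y T) \<le> inv P (P (ln (y 0)) - T)" by simp
  then have "y T \<le> exp (inv P (P (ln (y 0)) - T))"
    using pos[of T] T by (metis exp_le_cancel_iff exp_ln order_refl)
  then show ?thesis using pos[of 0] T by (simp add: decay_bound_def)
qed simp

end

lemma decay_rate_P_exists:
  assumes cont: "continuous_on UNIV a" and pos: "\<And>v. 0 < v \<Longrightarrow> 0 < a v"
  obtains P :: "real \<Rightarrow> real" where "\<And>s. (P has_real_derivative exp s / a (exp s)) (at s)"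
proof -
  have "isCont (\<lambda>s. exp s / a (exp s)) x" for x
  proof -
    have "continuous_on UNIV (\<lambda>s. exp s / a (exp s))"
      by (intro continuous_intros continuous_on_compose2[OF cont])
        (auto simp: less_imp_neq[OF pos, symmetric])
    then show ?thesis by (simp add: continuous_on_eq_continuous_at)
  qed
  then have "\<exists>F. \<forall>x::real. (-\<infinity>::ereal) < x \<longrightarrow> x < (\<infinity>::ereal) \<longrightarrow>
      (F has_vector_derivative exp x / a (exp x)) (at x)"
    by (intro einterval_antiderivative) auto
  then show ?thesis using that
    by (auto simp: has_real_derivative_iff_has_vector_derivative)
qed

section \<open>Trajectories\<close>

text \<open>The assumption \<open>rate\<close> replaces the decay \<open>\<alpha> (norm x)\<close>
  by one depending only on \<open>V x\<close>, since each \<open>x\<close> in \<open>D\<close>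
  satisfies both bounds with \<open>w = V x\<close>. Extended real radii let the local and the
  global case share this setting.\<close>

locale lyapunov_system = control_system Uc normU A phi + decay_rate a P
  for Uc :: "(real \<Rightarrow> 'u::real_normed_vector) set" and normU
    and A :: "(real \<times> real \<times> 'x::real_normed_vector \<times> (real \<Rightarrow> 'u)) set" and phi
    and a P +
  fixes V :: "'x \<Rightarrow> real" and D :: "'x set" and \<psi>1 \<psi>2 \<eta> \<alpha> :: "real \<Rightarrow> real"
    and \<rho>x \<rho>u :: ereal
  assumes bic: "BIC Uc A phi" and ti: "time_invariant Uc A phi"
    and shift_mem: "u \<in> Uc \<Longrightarrow> s \<ge> 0 \<Longrightarrow> shift s u \<in> Uc"
    and shift_norm: "u \<in> Uc \<Longrightarrow> s \<ge> 0 \<Longrightarrow> normU (shift s u) \<le> normU u"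
    and V_cont: "continuous_on D V"
    and K1: "class_Kinf \<psi>1" and K2: "class_Kinf \<psi>2" and K3: "class_K \<eta>"
    and V_ge: "x \<in> D \<Longrightarrow> \<psi>1 (norm x) \<le> V x" and V_le: "x \<in> D \<Longrightarrow> V x \<le> \<psi>2 (norm x)"
    and decay: "u \<in> Uc \<Longrightarrow> ereal (norm x) \<le> \<rho>x \<Longrightarrow> ereal (normU u) \<le> \<rho>u \<Longrightarrow>
      \<eta> (normU u) \<le> norm x \<Longrightarrow> Lyap_deriv phi V u x \<le> ereal (- \<alpha> (norm x))"
    and rate: "0 \<le> s \<Longrightarrow> \<psi>1 s \<le> w \<Longrightarrow> w \<le> \<psi>2 s \<Longrightarrow> a w \<le> \<alpha> s"
begin

lemma psi1_class_K: "class_K \<psi>1" and psi2_class_K: "class_K \<psi>2"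
  using K1 K2 by (auto simp: class_Kinf_def)

text \<open>The semigroup property restarts the trajectory at time \<open>t\<close>; time invariance
  then moves the restart to time 0, where \<open>Lyap_deriv\<close> is taken, at the price of
  shifting the input.\<close>

lemma phi_shift:
  assumes "0 \<le> t" "0 \<le> h" "(t + h, 0, x, u) \<in> A" "u \<in> Uc"
  shows "phi (t + h) 0 x u = phi h 0 (phi t 0 x u) (shift t u)"
proof -
  have "(t + h, t, phi t 0 x u, u) \<in> A" "phi (t + h) t (phi t 0 x u) u = phi (t + h) 0 x u"
    using semigroup[of 0 "t + h" x u t] assms by auto
  moreover have "\<forall>\<tau>\<ge>0. u (t + \<tau>) = shift t u (0 + \<tau>)" by (simp add: shift_def add.commute)
  ultimately show ?thesis
    using ti assms shift_mem[of u t] unfolding time_invariant_def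
    by (metis add_0 order_refl)
qed

text \<open>Since \<open>V \<le> \<psi>2 (norm x)\<close> and \<open>\<psi>2\<close> is strictly
  increasing, the assumed lower bound on \<open>V\<close> yields
  \<open>\<eta> (normU u) \<le> norm x\<close>. The shifted input has no larger norm, so the decay
  condition applies to it as well.\<close>

lemma V_dini_along_trajectory:
  assumes u: "u \<in> Uc" "ereal (normU u) \<le> \<rho>u" and T: "(T, 0, x0, u) \<in> A"
    and t: "0 \<le> t" "t < T" and e: "0 < e"
    and x: "phi t 0 x0 u \<in> D" "ereal (norm (phi t 0 x0 u)) \<le> \<rho>x"
    and c: "\<psi>2 (\<eta> (normU u)) \<le> V (phi t 0 x0 u)"
  shows "eventually (\<lambda>h. V (phi (t + h) 0 x0 u) \<le>
    V (phi t 0 x0 u) + h * (e - a (V (phi t 0 x0 u)))) (at_right 0)"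
proof -
  let ?x = "phi t 0 x0 u" and ?v = "shift t u"
  have v: "?v \<in> Uc" "normU ?v \<le> normU u" using shift_mem shift_norm u t by auto
  have nn: "0 \<le> normU ?v" "0 \<le> normU u" using normU_nonneg v u by auto
  have "\<eta> (normU ?v) \<le> \<eta> (normU u)" using class_KD(4)[OF K3] nn v by auto
  also have "\<eta> (normU u) \<le> norm ?x"
  proof (rule ccontr)
    assume "\<not> \<eta> (normU u) \<le> norm ?x"
    then have "\<psi>2 (norm ?x) < \<psi>2 (\<eta> (normU u))" using class_KD(3)[OF psi2_class_K] by auto
    then show False using c V_le[OF x(1)] by simp
  qed
  finally have le: "Lyap_deriv phi V ?v ?x \<le> ereal (- \<alpha> (norm ?x))"
    using v u x by (intro decay) (auto intro: order_trans[of _ "ereal (normU u)"])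
  \<comment> \<open>The slack \<open>e\<close> makes the inequality strict, as required to pass from
    the upper limit to all small \<open>h\<close>.\<close>
  also have "\<dots> < ereal (e - a (V ?x))"
    using e rate[of "norm ?x" "V ?x"] V_ge[OF x(1)] V_le[OF x(1)] by simp
  finally have "eventually (\<lambda>h. ereal ((1 / h) * (V (phi h 0 ?x ?v) - V ?x)) < ereal (e - a (V ?x))) (at_right 0)"
    unfolding Lyap_deriv_def by (rule Limsup_lessD)
  moreover have "eventually (\<lambda>h. 0 < h \<and> h < T - t) (at_right 0)"
    using t by (auto simp: eventually_at_right_field intro!: exI[of _ "T - t"])
  ultimately show ?thesis
  proof eventually_elim
    case (elim h)
    then have "(t + h, 0, x0, u) \<in> A" using semigroup[of 0 T x0 u "t + h"] T t by auto
    then have "phi (t + h) 0 x0 u = phi h 0 ?x ?v" using phi_shift[of t h x0 u] u t elim by auto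
    then show ?case using elim by (simp add: field_simps)
  qed
qed

lemma V_bound_along_trajectory:
  assumes u: "u \<in> Uc" "ereal (normU u) \<le> \<rho>u" and T: "0 \<le> T" "(T, 0, x0, u) \<in> A"
    and r: "cball 0 r \<subseteq> D" "ereal r \<le> \<rho>x"
    and inside: "\<And>t. 0 \<le> t \<Longrightarrow> t \<le> T \<Longrightarrow> norm (phi t 0 x0 u) \<le> r"
  shows "V (phi T 0 x0 u) \<le> max (\<psi>2 (\<eta> (normU u))) (decay_bound P (V x0) T)"
proof -
  have inD: "phi t 0 x0 u \<in> D" if "0 \<le> t" "t \<le> T" for t
    using inside[OF that] r by auto
  have "(\<lambda>t. V (phi t 0 x0 u)) T \<le> max (\<psi>2 (\<eta> (normU u))) (decay_bound P ((\<lambda>t. V (phi t 0 x0 u)) 0) T)"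
  proof (rule dini_comparison[OF T(1)])
    have "{0..T} \<subseteq> {t. (t, 0, x0, u) \<in> A}" using semigroup[of 0 T x0 u] T by auto
    then have "continuous_on {0..T} (\<lambda>t. phi t 0 x0 u)"
      using continuity[of 0 u x0] u by (auto intro: continuous_on_subset)
    then show "continuous_on {0..T} (\<lambda>t. V (phi t 0 x0 u))"
      using inD by (intro continuous_on_compose2[OF V_cont]) auto
    show "0 \<le> \<psi>2 (\<eta> (normU u))"
      using class_KD(5)[OF psi2_class_K] class_KD(5)[OF K3] normU_nonneg u by blast
  next
    fix t e :: real
    assume te: "0 \<le> t" "t < T" "\<psi>2 (\<eta> (normU u)) \<le> V (phi t 0 x0 u)" "0 < e"
    then have "ereal (norm (phi t 0 x0 u)) \<le> \<rho>x"
      using inside[of t] r(2) by (auto intro: order_trans[of _ "ereal r"])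
    with te show "eventually (\<lambda>h. V (phi (t + h) 0 x0 u) \<le>
        V (phi t 0 x0 u) + h * (e - a (V (phi t 0 x0 u)))) (at_right 0)"
      using u T inD by (intro V_dini_along_trajectory) auto
  qed
  then show ?thesis using identity[of 0 u x0] u by simp
qed

text \<open>Consider the first time \<open>\<tau>\<close> at which the sphere of radius
  \<open>r\<close> is reached. Up to then the bound on \<open>V\<close> is valid and gives
  \<open>V < \<psi>1 r\<close>, whereas \<open>V \<ge> \<psi>1 r\<close> on the sphere.\<close>

lemma trajectory_stays:
  assumes u: "u \<in> Uc" "ereal (normU u) \<le> \<rho>u" and T: "0 \<le> T" "(T, 0, x0, u) \<in> A"
    and r: "cball 0 r \<subseteq> D" "ereal r \<le> \<rho>x"
    and x0: "norm x0 < r" "\<psi>2 (norm x0) < \<psi>1 r" and c: "\<psi>2 (\<eta> (normU u)) < \<psi>1 r"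
  shows "norm (phi T 0 x0 u) < r"
proof (rule ccontr)
  assume "\<not> norm (phi T 0 x0 u) < r"
  have inA: "(t, 0, x0, u) \<in> A" if "0 \<le> t" "t \<le> T" for t
    using semigroup[of 0 T x0 u] T that by auto
  have cont: "continuous_on {0..T} (\<lambda>t. norm (phi t 0 x0 u))"
    using continuity[of 0 u x0] u inA by (intro continuous_on_norm) (auto intro: continuous_on_subset)
  have start: "phi 0 0 x0 u = x0" using identity u by simp
  define S where "S = {0..T} \<inter> (\<lambda>t. norm (phi t 0 x0 u)) -` {r..}"
  have "closed S" unfolding S_def by (intro continuous_closed_preimage cont) auto
  moreover have "T \<in> S" and bdd: "bdd_below S"
    using T \<open>\<not> norm (phi T 0 x0 u) < r\<close> by (auto simp: S_def intro: bdd_belowI[of _ 0])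
  ultimately have InfS: "Inf S \<in> S" by (intro closed_contains_Inf) auto
  define \<tau> where "\<tau> = Inf S"
  have \<tau>: "0 \<le> \<tau>" "\<tau> \<le> T" "r \<le> norm (phi \<tau> 0 x0 u)" using InfS by (auto simp: \<tau>_def S_def)
  have before: "norm (phi t 0 x0 u) < r" if "0 \<le> t" "t < \<tau>" for t
  proof (rule ccontr)
    assume "\<not> norm (phi t 0 x0 u) < r"
    then have "t \<in> S" using that \<tau> by (auto simp: S_def)
    then have "\<tau> \<le> t" unfolding \<tau>_def using bdd by (rule cInf_lower)
    then show False using that by simp
  qed
  have eq: "norm (phi \<tau> 0 x0 u) = r"
  proof -
    obtain t where "0 \<le> t" "t \<le> \<tau>" "norm (phi t 0 x0 u) = r"
      using IVT'[of "\<lambda>t. norm (phi t 0 x0 u)" 0 r \<tau>] \<tau> x0 start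
        continuous_on_subset[OF cont, of "{0..\<tau>}"] by auto
    then show ?thesis using before[of t] by (cases "t = \<tau>") auto
  qed
  have x0D: "x0 \<in> D" using x0 r by auto
  then have V0: "0 \<le> V x0" using V_ge[OF x0D] class_KD(5)[OF psi1_class_K, of "norm x0"] by simp
  have "V (phi \<tau> 0 x0 u) \<le> max (\<psi>2 (\<eta> (normU u))) (decay_bound P (V x0) \<tau>)"
    using u \<tau> inA r before eq
    by (intro V_bound_along_trajectory) (auto simp: le_less)
  also have "\<dots> < \<psi>1 r"
    using decay_bound_le[OF V0 \<tau>(1)] V_le[OF x0D] x0 c by auto
  finally have "V (phi \<tau> 0 x0 u) < \<psi>1 r" .
  moreover have "\<psi>1 r \<le> V (phi \<tau> 0 x0 u)" using V_ge[of "phi \<tau> 0 x0 u"] eq r by auto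
  ultimately show False by simp
qed

lemma trajectory_bound:
  assumes u: "u \<in> Uc" "ereal (normU u) \<le> \<rho>u"
    and r: "cball 0 r \<subseteq> D" "ereal r \<le> \<rho>x"
    and x0: "norm x0 < r" "\<psi>2 (norm x0) < \<psi>1 r" and c: "\<psi>2 (\<eta> (normU u)) < \<psi>1 r"
    and t: "0 \<le> t"
  shows "(t, 0, x0, u) \<in> A"
    and "\<psi>1 (norm (phi t 0 x0 u)) \<le> max (\<psi>2 (\<eta> (normU u))) (decay_bound P (\<psi>2 (norm x0)) t)"
proof -
  have stay: "norm (phi s 0 x0 u) < r" if "0 \<le> s" "(s, 0, x0, u) \<in> A" for s
    using trajectory_stays[OF u that r x0 c] .
  obtain tm :: ereal where "\<forall>s\<ge>0. ereal s < tm \<longrightarrow> (s, 0, x0, u) \<in> A"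
    and "tm < \<infinity> \<longrightarrow> (\<forall>M>0. \<exists>s\<ge>0. ereal s < tm \<and> norm (phi s 0 x0 u) > M)"
    using bic u unfolding BIC_def by (metis order_refl)
  moreover have "0 < r" using x0 norm_ge_zero[of x0] by linarith
  \<comment> \<open>A finite maximal time would force the norm above \<open>r\<close> at some
    earlier time.\<close>
  ultimately have "tm = \<infinity>" using stay by (metis ereal_infty_less(1) less_asym)
  then have inA: "(s, 0, x0, u) \<in> A" if "0 \<le> s" for s
    using that \<open>\<forall>s\<ge>0. ereal s < tm \<longrightarrow> (s, 0, x0, u) \<in> A\<close> by auto
  then show "(t, 0, x0, u) \<in> A" using t .
  have x0D: "x0 \<in> D" and xD: "phi t 0 x0 u \<in> D" using x0 r stay[OF t inA[OF t]] by auto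
  have V0: "0 \<le> V x0" using V_ge[OF x0D] class_KD(5)[OF psi1_class_K, of "norm x0"] by simp
  have "\<psi>1 (norm (phi t 0 x0 u)) \<le> V (phi t 0 x0 u)" using V_ge xD .
  also have "\<dots> \<le> max (\<psi>2 (\<eta> (normU u))) (decay_bound P (V x0) t)"
    using stay inA t by (intro V_bound_along_trajectory[OF u t inA[OF t] r]) (auto intro: less_imp_le)
  \<comment> \<open>The decay bound increases with its initial value, and
    \<open>V x0 \<le> \<psi>2 (norm x0)\<close>.\<close>
  also have "\<dots> \<le> max (\<psi>2 (\<eta> (normU u))) (decay_bound P (\<psi>2 (norm x0)) t)"
    using decay_bound_less[OF V0, of "\<psi>2 (norm x0)" t] V_le[OF x0D]
    by (intro max.mono) (cases "V x0 = \<psi>2 (norm x0)"; auto)+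
  finally show "\<psi>1 (norm (phi t 0 x0 u)) \<le> max (\<psi>2 (\<eta> (normU u))) (decay_bound P (\<psi>2 (norm x0)) t)" .
qed

section \<open>Stability estimates from the trajectory bound\<close>

text \<open>The radius \<open>r\<close> only confines the trajectory and does not enter
  \<open>\<beta>\<close> or \<open>\<gamma>\<close>. It may therefore vary with \<open>x0\<close>
  and \<open>u\<close>, which is what the global case uses.\<close>

lemma ISS_within_if_radius:
  assumes rad: "\<And>(x0 :: 'x) u. u \<in> Uc \<Longrightarrow> ereal (norm x0) \<le> Rx \<Longrightarrow> ereal (normU u) \<le> Ru \<Longrightarrow>
    ereal (normU u) \<le> \<rho>u \<and> (\<exists>r. cball 0 r \<subseteq> D \<and> ereal r \<le> \<rho>x \<and> norm x0 < r \<and>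
      \<psi>2 (norm x0) < \<psi>1 r \<and> \<psi>2 (\<eta> (normU u)) < \<psi>1 r)"
  shows "ISS_within Rx Ru Uc normU A phi"
proof -
  obtain k where k: "class_K k" "\<And>x. 0 \<le> x \<Longrightarrow> k (\<psi>1 x) = x"
    using class_Kinf_inverse[OF K1] by metis
  define \<beta> where "\<beta> r t = k (decay_bound P (\<psi>2 r) t)" for r t
  define \<gamma> where "\<gamma> r = k (\<psi>2 (\<eta> r))" for r
  have "class_K \<gamma>"
    unfolding \<gamma>_def by (rule class_K_compose[OF k(1) class_K_compose[OF psi2_class_K K3]])
  moreover have "class_KL \<beta>"
    unfolding class_KL_def \<beta>_def
  proof (intro conjI allI impI)
    show "class_K (\<lambda>r. k (decay_bound P (\<psi>2 r) t))" if "0 \<le> t" for t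
      by (rule class_K_compose[OF k(1) class_K_compose[OF class_K_decay_bound[OF that] psi2_class_K]])
    show "class_L (\<lambda>t. k (decay_bound P (\<psi>2 r) t))" if "0 < r" for r
      by (rule class_K_compose_L[OF k(1) class_L_decay_bound[OF class_KD(6)[OF psi2_class_K that]]])
  qed
  moreover have "(t, 0, x0, u) \<in> A \<and> norm (phi t 0 x0 u) \<le> \<beta> (norm x0) t + \<gamma> (normU u)"
    if "0 \<le> t" "u \<in> Uc" "ereal (norm x0) \<le> Rx" "ereal (normU u) \<le> Ru" for x0 t u
  proof -
    let ?c = "\<psi>2 (\<eta> (normU u))" and ?w = "decay_bound P (\<psi>2 (norm x0)) t"
    from rad[OF that(2-4)] obtain r where "ereal (normU u) \<le> \<rho>u" "cball 0 r \<subseteq> D" "ereal r \<le> \<rho>x"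
      "norm x0 < r" "\<psi>2 (norm x0) < \<psi>1 r" "?c < \<psi>1 r" by blast
    note bound = trajectory_bound[OF that(2) this that(1)]
    have nn: "0 \<le> ?c" "0 \<le> ?w"
      using class_KD(5)[OF psi2_class_K] class_KD(5)[OF K3] normU_nonneg that decay_bound_nonneg by auto
    have "norm (phi t 0 x0 u) = k (\<psi>1 (norm (phi t 0 x0 u)))" by (simp add: k)
    also have "\<dots> \<le> k (max ?c ?w)"
      using bound(2) class_KD(5)[OF psi1_class_K] by (intro class_KD(4)[OF k(1)]) auto
    \<comment> \<open>The maximum picks one of two non-negative arguments, so its image under
      \<open>k\<close> is at most the sum of both images.\<close>
    also have "\<dots> \<le> \<beta> (norm x0) t + \<gamma> (normU u)"
      using class_KD(5)[OF k(1) nn(1)] class_KD(5)[OF k(1) nn(2)] by (auto simp: max_def \<beta>_def \<gamma>_def)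
    finally show ?thesis using bound(1) by simp
  qed
  ultimately show ?thesis unfolding ISS_within_def by blast
qed

lemma ISS_within_local:
  assumes rho: "0 < \<rho>x" "0 < \<rho>u" and D: "0 \<in> interior D"
  obtains Rx Ru :: real where "0 < Rx" "0 < Ru" "ISS_within (ereal Rx) (ereal Ru) Uc normU A phi"
proof -
  obtain d where d: "0 < d" "cball 0 d \<subseteq> D"
    using D by (meson mem_interior_cball)
  obtain p where p: "0 < p" "ereal p < \<rho>x" using ereal_dense2[of 0 \<rho>x] rho by auto
  obtain q where q: "0 < q" "ereal q < \<rho>u" using ereal_dense2[of 0 \<rho>u] rho by auto
  define r where "r = min d p"
  have r: "0 < r" "cball 0 r \<subseteq> D" "ereal r \<le> \<rho>x"
    using d p by (auto simp: r_def min_def intro: less_imp_le order_trans[of _ "ereal p"])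
  have pos: "0 < \<psi>1 r" using class_KD(6)[OF psi1_class_K] r by simp
  obtain l where l: "0 < l" "\<psi>2 l < \<psi>1 r" using class_K_small[OF psi2_class_K pos] .
  obtain m where m: "0 < m" "\<psi>2 (\<eta> m) < \<psi>1 r"
    using class_K_small[OF class_K_compose[OF psi2_class_K K3] pos] .
  \<comment> \<open>Half of \<open>r\<close> keeps \<open>norm x0\<close> strictly below
    \<open>r\<close>; \<open>l\<close> and \<open>m\<close> keep the initial value and the input
    threshold below \<open>\<psi>1 r\<close>.\<close>
  define Rx where "Rx = min l (r / 2)"
  define Ru where "Ru = min m q"
  have "ISS_within (ereal Rx) (ereal Ru) Uc normU A phi"
  proof (rule ISS_within_if_radius)
    fix x0 :: 'x and u assume u: "u \<in> Uc" and x0: "ereal (norm x0) \<le> ereal Rx"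
      and nu: "ereal (normU u) \<le> ereal Ru"
    have "ereal (normU u) \<le> \<rho>u"
      using nu q(2) by (auto simp: Ru_def intro: less_imp_le order_trans[of _ "ereal q"])
    moreover have "\<psi>2 (norm x0) \<le> \<psi>2 l" "\<psi>2 (\<eta> (normU u)) \<le> \<psi>2 (\<eta> m)" "norm x0 < r"
      using class_KD(4)[OF psi2_class_K] class_KD(4)[OF class_K_compose[OF psi2_class_K K3]] x0 nu normU_nonneg[OF u] r
      by (auto simp: Rx_def Ru_def)
    ultimately show "ereal (normU u) \<le> \<rho>u \<and> (\<exists>r. cball 0 r \<subseteq> D \<and> ereal r \<le> \<rho>x \<and> norm x0 < r \<and>
      \<psi>2 (norm x0) < \<psi>1 r \<and> \<psi>2 (\<eta> (normU u)) < \<psi>1 r)"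
      using r l m by (auto intro!: exI[of _ r])
  qed
  moreover have "0 < Rx" "0 < Ru" using l r m q by (auto simp: Rx_def Ru_def)
  ultimately show ?thesis using that by blast
qed

text \<open>Unboundedness of \<open>\<psi>1\<close> provides a radius for any given pair. Raising it
  to at least \<open>norm x0 + 1\<close> puts \<open>x0\<close> inside the ball and can only
  increase \<open>\<psi>1\<close>.\<close>

lemma ISS_within_global:
  assumes "\<rho>x = \<infinity>" "\<rho>u = \<infinity>" "D = UNIV"
  shows "ISS_within \<infinity> \<infinity> Uc normU A phi"
proof (rule ISS_within_if_radius)
  fix x0 :: 'x and u
  obtain r where r: "0 < r" "max (\<psi>2 (norm x0)) (\<psi>2 (\<eta> (normU u))) < \<psi>1 r"
    using class_Kinf_large[OF K1] .
  have "\<psi>1 r \<le> \<psi>1 (max r (norm x0 + 1))" using class_KD(4)[OF psi1_class_K] r by auto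
  then show "ereal (normU u) \<le> \<rho>u \<and> (\<exists>r. cball 0 r \<subseteq> D \<and> ereal r \<le> \<rho>x \<and> norm x0 < r \<and>
      \<psi>2 (norm x0) < \<psi>1 r \<and> \<psi>2 (\<eta> (normU u)) < \<psi>1 r)"
    using r assms by (auto intro!: exI[of _ "max r (norm x0 + 1)"])
qed

end

section \<open>From Lyapunov functions to the two stability claims\<close>

lemma lyapunov_system_exists:
  assumes "control_system Uc normU A phi" "BIC Uc A phi" "time_invariant Uc A phi"
    and "\<And>u s. u \<in> Uc \<Longrightarrow> s \<ge> 0 \<Longrightarrow> shift s u \<in> Uc \<and> normU (shift s u) \<le> normU u"
    and lyap: "ISS_Lyapunov_within \<rho>x \<rho>u D Uc normU phi V"
  obtains a P \<psi>1 \<psi>2 \<eta> \<alpha> where "lyapunov_system Uc normU A phi a P V D \<psi>1 \<psi>2 \<eta> \<alpha> \<rho>x \<rho>u"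
proof -
  obtain \<psi>1 \<psi>2 \<eta> \<alpha> where L: "continuous_on D V"
      "class_Kinf \<psi>1" "class_Kinf \<psi>2" "class_K \<eta>" "pos_def_fun \<alpha>"
      "\<forall>x\<in>D. \<psi>1 (norm x) \<le> V x \<and> V x \<le> \<psi>2 (norm x)"
      "\<forall>x. \<forall>u\<in>Uc. ereal (norm x) \<le> \<rho>x \<and> ereal (normU u) \<le> \<rho>u \<longrightarrow>
        norm x \<ge> \<eta> (normU u) \<longrightarrow> Lyap_deriv phi V u x \<le> ereal (- \<alpha> (norm x))"
    using lyap unfolding ISS_Lyapunov_within_def by blast
  obtain a where a: "continuous_on UNIV a" "\<And>v. 0 \<le> v \<Longrightarrow> 0 \<le> a v" "\<And>v. 0 < v \<Longrightarrow> 0 < a v"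
    "\<And>v. 0 \<le> v \<Longrightarrow> a v \<le> v" "\<And>s w. 0 \<le> s \<Longrightarrow> \<psi>1 s \<le> w \<Longrightarrow> w \<le> \<psi>2 s \<Longrightarrow> a w \<le> \<alpha> s"
    using decay_rate_exists[OF L(2,3,5)] by blast
  obtain P where P: "\<And>s. (P has_real_derivative exp s / a (exp s)) (at s)"
    using decay_rate_P_exists[OF a(1,3)] by blast
  have "decay_rate a P" using a P by unfold_locales
  moreover have "lyapunov_system_axioms Uc normU A phi a V D \<psi>1 \<psi>2 \<eta> \<alpha> \<rho>x \<rho>u"
    using assms L a(5) by unfold_locales auto
  ultimately show ?thesis using that assms(1) by (blast intro: lyapunov_system.intro)
qed

theorem theorem1:
  fixes Uc :: "(real \<Rightarrow> 'u::real_normed_vector) set"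
    and normU :: "(real \<Rightarrow> 'u) \<Rightarrow> real"
    and A :: "(real \<times> real \<times> 'x::real_normed_vector \<times> (real \<Rightarrow> 'u)) set"
    and phi :: "real \<Rightarrow> real \<Rightarrow> 'x \<Rightarrow> (real \<Rightarrow> 'u) \<Rightarrow> 'x"
  assumes "control_system Uc normU A phi"
    and "BIC Uc A phi"
    and "time_invariant Uc A phi"
    and "equilibrium A phi 0"
    and "\<And>u s. u \<in> Uc \<Longrightarrow> s \<ge> 0 \<Longrightarrow> shift s u \<in> Uc \<and> normU (shift s u) \<le> normU u"
  shows "((\<exists>D V. local_ISS_Lyapunov D Uc normU phi V) \<longrightarrow> LISS Uc normU A phi)
    \<and> ((\<exists>V. ISS_Lyapunov Uc normU phi V) \<longrightarrow> ISS Uc normU A phi)"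
proof (intro conjI impI)
  note sys = lyapunov_system_exists[OF assms(1,2,3,5)]
  assume "\<exists>D V. local_ISS_Lyapunov D Uc normU phi V"
  then obtain D V \<rho>x \<rho>u where rho: "0 < \<rho>x" "0 < \<rho>u"
    and lyap: "ISS_Lyapunov_within (ereal \<rho>x) (ereal \<rho>u) D Uc normU phi V"
    unfolding local_ISS_Lyapunov_def by blast
  obtain a P \<psi>1 \<psi>2 \<eta> \<alpha> where
    "lyapunov_system Uc normU A phi a P V D \<psi>1 \<psi>2 \<eta> \<alpha> (ereal \<rho>x) (ereal \<rho>u)"
    using sys[OF _ _ lyap] by blast
  then interpret lyapunov_system Uc normU A phi a P V D \<psi>1 \<psi>2 \<eta> \<alpha> "ereal \<rho>x" "ereal \<rho>u" .
  have "0 \<in> interior D" using lyap by (simp add: ISS_Lyapunov_within_def)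
  then obtain Rx Ru :: real where "0 < Rx" "0 < Ru" "ISS_within (ereal Rx) (ereal Ru) Uc normU A phi"
    using ISS_within_local rho by auto
  then show "LISS Uc normU A phi" unfolding LISS_def by blast
next
  note sys = lyapunov_system_exists[OF assms(1,2,3,5)]
  assume "\<exists>V. ISS_Lyapunov Uc normU phi V"
  then obtain V where lyap: "ISS_Lyapunov_within \<infinity> \<infinity> UNIV Uc normU phi V"
    unfolding ISS_Lyapunov_def by blast
  obtain a P \<psi>1 \<psi>2 \<eta> \<alpha> where
    "lyapunov_system Uc normU A phi a P V UNIV \<psi>1 \<psi>2 \<eta> \<alpha> \<infinity> \<infinity>"
    using sys[OF _ _ lyap] by blast
  then interpret lyapunov_system Uc normU A phi a P V UNIV \<psi>1 \<psi>2 \<eta> \<alpha> \<infinity> \<infinity> .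
  show "ISS Uc normU A phi" unfolding ISS_def using ISS_within_global by simp
qed

end
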